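(* Let $n\ge 1$. The Heyting algebra $\mathfrak{D}_n$ of Dyck paths of semilength $n$ is isomorphic to the Heyting algebra $[\Theta_{n-1}]$.
   Context: Dyck paths. A Dyck path of semilength $n$ is a lattice path from $(0,0)$ to $(2n,0)$ using steps $(1,1)$ and $(1,-1)$ and never going below the $x$-axis. The set of these paths, ordered by $P\le Q$ iff $P$ lies weakly below $Q$, is a finite distributive lattice; $\mathfrak{D}_n$ denotes this lattice with its canonical Heyting algebra structure, $P\rightsquigarrow Q=\bigvee\{Z : P\wedge Z\le Q\}$. Logic. Let $\mathcal{T}_m=\{t_1<t_2<\cdots<t_m\}$ be a finite linearly ordered set and let $Int(\mathcal{T}_m)$ be the set of its (nonempty) intervals $[t_i,t_j]=\{t : t_i\le t\le t_j\}$, $i\le j$. The set $ITL_m$ of propositions is generated from $\bot,\top$ and propositional variables $\varepsilon_1,\ldots,\varepsilon_m$ by the connectives $\vee,\wedge,\rightarrow,\neg$ and $\Box,\lozenge,\sim,\rightsquigarrow$. Each proposition $\varphi$ has a truth value $\varphi(I)\in\{0,1\}$ on each $I\in Int(\mathcal{T}_m)$: $\bot(I)=0$, $\top(I)=1$; $\varepsilon_i(I)=1$ iff $I=\{t_i\}$; $\vee,\wedge,\rightarrow,\neg$ are evaluated classically at each interval $I$; $(\Box\varphi)(I)=1$ iff $\varphi(J)=1$ for all intervals $J\subseteq I$; $(\lozenge\varphi)(I)=1$ iff $\varphi(J)=1$ for some interval $J\subseteq I$; $(\sim\!\varphi)(I)=1$ iff $\varphi(J)=0$ for all intervals $J\subseteq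 I$; $(\varphi\rightsquigarrow\psi)(I)=1$ iff for all intervals $J\subseteq I$, $\varphi(J)=1$ implies $\psi(J)=1$. A proposition is valid if it has value $1$ on all intervals. Let $\Theta_m=\{\varphi\in ITL_m : \varphi\rightarrow\Box\varphi \text{ is valid}\}$. It is closed under $\vee,\wedge,\sim,\rightsquigarrow$. Propositions $\varphi,\psi\in\Theta_m$ are equivalent if $\varphi(I)=\psi(I)$ for all $I\in Int(\mathcal{T}_m)$. $[\Theta_m]$ is the set of equivalence classes with operations induced by representatives: $[\varphi]\vee[\psi]=[\varphi\vee\psi]$, $[\varphi]\wedge[\psi]=[\varphi\wedge\psi]$, $[\varphi]\rightsquigarrow[\psi]=[\varphi\rightsquigarrow\psi]$; it is a distributive lattice with order $[\varphi]\le[\psi]$ iff $\varphi(I)\le\psi(I)$ for all $I$, and $\rightsquigarrow$ is its relative pseudocomplement. (For $m=0$ there are no intervals and $[\Theta_0]$ has one element.) *)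

theory Defs
  imports "HOL-Algebra.Lattice"
begin

section \<open>Heyting algebras\<close>

record 'a heyting = "'a gorder" +
  hsup :: "['a, 'a] \<Rightarrow> 'a"
  hinf :: "['a, 'a] \<Rightarrow> 'a"
  himp :: "['a, 'a] \<Rightarrow> 'a"

text \<open>The operations are fields of the record because they may be given independently of the order;
  the locale requires them to be the join, meet and relative pseudocomplement of that order.\<close>

locale heyting_algebra = bounded_lattice H for H (structure) +
  assumes hsup_eq_join: "\<lbrakk>x \<in> carrier H; y \<in> carrier H\<rbrakk> \<Longrightarrow> hsup H x y = x \<squnion> y"
    and hinf_eq_meet: "\<lbrakk>x \<in> carrier H; y \<in> carrier H\<rbrakk> \<Longrightarrow> hinf H x y = x \<sqinter> y"
    and himp_closed: "\<lbrakk>x \<in> carrier H; y \<in> carrier H\<rbrakk> \<Longrightarrow> himp H x y \<in> carrier H"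
    and himp_adjoint: "\<lbrakk>x \<in> carrier H; y \<in> carrier H; z \<in> carrier H\<rbrakk>
      \<Longrightarrow> x \<sqinter> z \<sqsubseteq> y \<longleftrightarrow> z \<sqsubseteq> himp H x y"

definition heyting_hom :: "'a heyting \<Rightarrow> 'b heyting \<Rightarrow> ('a \<Rightarrow> 'b) set" where
  "heyting_hom A B = {h. h \<in> carrier A \<rightarrow> carrier B \<and>
     h \<bottom>\<^bsub>A\<^esub> = \<bottom>\<^bsub>B\<^esub> \<and> h \<top>\<^bsub>A\<^esub> = \<top>\<^bsub>B\<^esub> \<and>
     (\<forall>x\<in>carrier A. \<forall>y\<in>carrier A.
        h (hsup A x y) = hsup B (h x) (h y) \<and>
        h (hinf A x y) = hinf B (h x) (h y) \<and>
        h (himp A x y) = himp B (h x) (h y))}"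

definition heyting_iso :: "'a heyting \<Rightarrow> 'b heyting \<Rightarrow> ('a \<Rightarrow> 'b) set" where
  "heyting_iso A B = {h \<in> heyting_hom A B. bij_betw h (carrier A) (carrier B)}"


section \<open>Dyck paths\<close>

text \<open>A lattice path starting at the origin is represented by its list of steps.\<close>

datatype step = Up | Down

primrec rise :: "step \<Rightarrow> int" where
  "rise Up = 1"
| "rise Down = - 1"

text \<open>The ordinate of the path at abscissa \<open>k\<close>.\<close>

definition height :: "step list \<Rightarrow> nat \<Rightarrow> int" where
  "height P k = (\<Sum>s\<leftarrow>take k P. rise s)"

definition dyck_paths :: "nat \<Rightarrow> step list set" where
  "dyck_paths n = {P. length P = 2 * n \<and> height P (2 * n) = 0 \<and> (\<forall>k\<le>2 * n. 0 \<le> height P k)}"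

text \<open>All vertices of the paths have integral abscissae, so comparing heights there suffices.\<close>

definition dyck_order :: "nat \<Rightarrow> step list gorder" where
  "dyck_order n =
    \<lparr>carrier = dyck_paths n,
     eq = (=),
     le = (\<lambda>P Q. \<forall>k\<le>2 * n. height P k \<le> height Q k)\<rparr>"

definition dyck_heyting :: "nat \<Rightarrow> step list heyting" where
  "dyck_heyting n =
    \<lparr>carrier = carrier (dyck_order n),
     eq = (=),
     le = le (dyck_order n),
     hsup = join (dyck_order n),
     hinf = meet (dyck_order n),
     himp = (\<lambda>P Q. \<Squnion>\<^bsub>dyck_order n\<^esub>
       {Z \<in> carrier (dyck_order n). P \<sqinter>\<^bsub>dyck_order n\<^esub> Z \<sqsubseteq>\<^bsub>dyck_order n\<^esub> Q})\<rparr>"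


section \<open>Interval temporal logic\<close>

text \<open>The time points are \<open>t 1 < \<dots> < t m\<close> in an arbitrary linear order; the values of \<open>t\<close> outside
  \<open>{1..m}\<close> are irrelevant.\<close>

definition intervals :: "(nat \<Rightarrow> 'a::linorder) \<Rightarrow> nat \<Rightarrow> 'a set set" where
  "intervals t m =
    {{x \<in> t ` {1..m}. t i \<le> x \<and> x \<le> t j} | i j. 1 \<le> i \<and> i \<le> j \<and> j \<le> m}"

datatype itl =
    Fls
  | Tru
  | Eps nat
  | Or itl itl
  | And itl itl
  | Imp itl itl
  | Neg itl
  | Box itl
  | Dia itl
  | Sim itl
  | Cond itl itl \<comment> \<open>the connective written as a squiggly arrow\<close>

primrec eps_indices :: "itl \<Rightarrow> nat set" where
  "eps_indices Fls = {}"
| "eps_indices Tru = {}"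
| "eps_indices (Eps i) = {i}"
| "eps_indices (Or \<phi> \<psi>) = eps_indices \<phi> \<union> eps_indices \<psi>"
| "eps_indices (And \<phi> \<psi>) = eps_indices \<phi> \<union> eps_indices \<psi>"
| "eps_indices (Imp \<phi> \<psi>) = eps_indices \<phi> \<union> eps_indices \<psi>"
| "eps_indices (Neg \<phi>) = eps_indices \<phi>"
| "eps_indices (Box \<phi>) = eps_indices \<phi>"
| "eps_indices (Dia \<phi>) = eps_indices \<phi>"
| "eps_indices (Sim \<phi>) = eps_indices \<phi>"
| "eps_indices (Cond \<phi> \<psi>) = eps_indices \<phi> \<union> eps_indices \<psi>"

definition ITL :: "nat \<Rightarrow> itl set" where
  "ITL m = {\<phi>. eps_indices \<phi> \<subseteq> {1..m}}"

text \<open>The truth value of a proposition on an interval; \<open>True\<close> and \<open>False\<close> stand for 1 and 0.\<close>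

primrec holds :: "(nat \<Rightarrow> 'a::linorder) \<Rightarrow> nat \<Rightarrow> itl \<Rightarrow> 'a set \<Rightarrow> bool" where
  "holds t m Fls I = False"
| "holds t m Tru I = True"
| "holds t m (Eps i) I = (I = {t i})"
| "holds t m (Or \<phi> \<psi>) I = (holds t m \<phi> I \<or> holds t m \<psi> I)"
| "holds t m (And \<phi> \<psi>) I = (holds t m \<phi> I \<and> holds t m \<psi> I)"
| "holds t m (Imp \<phi> \<psi>) I = (holds t m \<phi> I \<longrightarrow> holds t m \<psi> I)"
| "holds t m (Neg \<phi>) I = (\<not> holds t m \<phi> I)"
| "holds t m (Box \<phi>) I = (\<forall>J\<in>intervals t m. J \<subseteq> I \<longrightarrow> holds t m \<phi> J)"
| "holds t m (Dia \<phi>) I = (\<exists>J\<in>intervals t m. J \<subseteq> I \<and> holds t m \<phi> J)"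
| "holds t m (Sim \<phi>) I = (\<forall>J\<in>intervals t m. J \<subseteq> I \<longrightarrow> \<not> holds t m \<phi> J)"
| "holds t m (Cond \<phi> \<psi>) I =
     (\<forall>J\<in>intervals t m. J \<subseteq> I \<longrightarrow> holds t m \<phi> J \<longrightarrow> holds t m \<psi> J)"

definition valid :: "(nat \<Rightarrow> 'a::linorder) \<Rightarrow> nat \<Rightarrow> itl \<Rightarrow> bool" where
  "valid t m \<phi> \<longleftrightarrow> (\<forall>I\<in>intervals t m. holds t m \<phi> I)"

definition Theta :: "(nat \<Rightarrow> 'a::linorder) \<Rightarrow> nat \<Rightarrow> itl set" where
  "Theta t m = {\<phi> \<in> ITL m. valid t m (Imp \<phi> (Box \<phi>))}"

definition theta_rel :: "(nat \<Rightarrow> 'a::linorder) \<Rightarrow> nat \<Rightarrow> (itl \<times> itl) set" where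
  "theta_rel t m = {(\<phi>, \<psi>). \<phi> \<in> Theta t m \<and> \<psi> \<in> Theta t m \<and>
     (\<forall>I\<in>intervals t m. holds t m \<phi> I = holds t m \<psi> I)}"

text \<open>The operation on equivalence classes induced by a binary connective.\<close>

definition class_op ::
  "(nat \<Rightarrow> 'a::linorder) \<Rightarrow> nat \<Rightarrow> (itl \<Rightarrow> itl \<Rightarrow> itl) \<Rightarrow> itl set \<Rightarrow> itl set \<Rightarrow> itl set" where
  "class_op t m c A B = (\<Union>\<phi>\<in>A. \<Union>\<psi>\<in>B. theta_rel t m `` {c \<phi> \<psi>})"

definition theta_heyting :: "(nat \<Rightarrow> 'a::linorder) \<Rightarrow> nat \<Rightarrow> itl set heyting" where
  "theta_heyting t m =
    \<lparr>carrier = Theta t m // theta_rel t m,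
     eq = (=),
     le = (\<lambda>A B. \<forall>\<phi>\<in>A. \<forall>\<psi>\<in>B. \<forall>I\<in>intervals t m. holds t m \<phi> I \<le> holds t m \<psi> I),
     hsup = class_op t m Or,
     hinf = class_op t m And,
     himp = class_op t m Cond\<rparr>"

end

theory Submission
  imports Defs
begin

text \<open>Both algebras are the algebra of down-sets of the poset of nonempty intervals of \<open>{1..n - 1}\<close>
  under inclusion. A Dyck path is determined by the lattice points \<open>(i + j, j - i + 2)\<close>,
  \<open>1 \<le> i \<le> j < n\<close>, which lie weakly below it, and the corresponding intervals \<open>[i, j]\<close> form an
  arbitrary down-set. A proposition belongs to \<open>\<Theta>\<close> iff the intervals on which it holds form a
  down-set, and every down-set is definable because it is a finite union of principal ones.\<close>

section \<open>Lattices represented by down-sets\<close>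

definition down_sets :: "('b \<Rightarrow> 'b \<Rightarrow> bool) \<Rightarrow> 'b set \<Rightarrow> 'b set set" where
  "down_sets r U = {D. D \<subseteq> U \<and> (\<forall>p\<in>D. \<forall>q\<in>U. r q p \<longrightarrow> q \<in> D)}"

text \<open>The relative pseudocomplement in the lattice of down-sets, when \<open>r\<close> is
  reflexive and transitive on \<open>U\<close>.\<close>

definition down_imp :: "('b \<Rightarrow> 'b \<Rightarrow> bool) \<Rightarrow> 'b set \<Rightarrow> 'b set \<Rightarrow> 'b set \<Rightarrow> 'b set" where
  "down_imp r U A B = {p \<in> U. \<forall>q\<in>U. r q p \<longrightarrow> q \<in> A \<longrightarrow> q \<in> B}"

text \<open>\<open>f\<close> is an order isomorphism onto the down-sets. \<open>H\<close> ranges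
  over a record scheme, so that both the bare order \<open>dyck_order\<close> and the Heyting
  records are instances.\<close>

locale downset_representation =
  fixes r :: "'b \<Rightarrow> 'b \<Rightarrow> bool" and U :: "'b set"
    and H :: "('a, 'm) gorder_scheme" (structure) and f :: "'a \<Rightarrow> 'b set"
  assumes r_refl: "p \<in> U \<Longrightarrow> r p p"
    and r_trans: "\<lbrakk>p \<in> U; q \<in> U; s \<in> U; r p q; r q s\<rbrakk> \<Longrightarrow> r p s"
    and eq_eq: "(.=) = (=)"
    and f_bij: "bij_betw f (carrier H) (down_sets r U)"
    and f_le: "\<lbrakk>x \<in> carrier H; y \<in> carrier H\<rbrakk> \<Longrightarrow> x \<sqsubseteq> y \<longleftrightarrow> f x \<subseteq> f y"
begin

lemma f_down: "x \<in> carrier H \<Longrightarrow> f x \<in> down_sets r U"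
  using f_bij by (auto simp: bij_betw_def)

lemma f_subset: "x \<in> carrier H \<Longrightarrow> f x \<subseteq> U"
  using f_down by (auto simp: down_sets_def)

lemma f_eqD: "\<lbrakk>f x = f y; x \<in> carrier H; y \<in> carrier H\<rbrakk> \<Longrightarrow> x = y"
  using f_bij by (auto simp: bij_betw_def dest: inj_onD)

lemma f_surj: "D \<in> down_sets r U \<Longrightarrow> \<exists>x\<in>carrier H. f x = D"
  using f_bij by (metis bij_betw_imp_surj_on imageE)

lemma down_imp_down: "down_imp r U A B \<in> down_sets r U"
  unfolding down_sets_def down_imp_def by (auto intro: r_trans)

text \<open>Left to right uses that \<open>C\<close> is closed downwards; right to left takes
  \<open>q = p\<close>, by reflexivity.\<close>

lemma down_imp_adjoint:
  assumes "C \<in> down_sets r U"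
  shows "A \<inter> C \<subseteq> B \<longleftrightarrow> C \<subseteq> down_imp r U A B"
  using assms unfolding down_sets_def down_imp_def by (blast intro: r_refl)

sublocale partial_order H
  by unfold_locales (auto simp: eq_eq f_le intro: f_eqD)

text \<open>The union is again a down-set, hence the image of some \<open>w\<close>, and least
  elements are unique. The equivalence yields both the existence of joins and their images under
  \<open>f\<close>.\<close>

lemma least_Upper_iff:
  assumes "x \<in> carrier H" "y \<in> carrier H"
  shows "least H s (Upper H {x, y}) \<longleftrightarrow> s \<in> carrier H \<and> f s = f x \<union> f y"
proof -
  have "f x \<union> f y \<in> down_sets r U"
    using f_down assms unfolding down_sets_def by blast
  then obtain w where w: "w \<in> carrier H" "f w = f x \<union> f y"
    using f_surj by blast
  moreover have "Upper H {x, y} = {u \<in> carrier H. x \<sqsubseteq> u \<and> y \<sqsubseteq> u}"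
    using assms by (auto simp: Upper_def)
  ultimately have "least H w (Upper H {x, y})"
    using assms by (auto simp: least_def f_le)
  then show ?thesis
    using w by (metis least_closed least_unique Upper_closed f_eqD)
qed

lemma greatest_Lower_iff:
  assumes "x \<in> carrier H" "y \<in> carrier H"
  shows "greatest H s (Lower H {x, y}) \<longleftrightarrow> s \<in> carrier H \<and> f s = f x \<inter> f y"
proof -
  have "f x \<inter> f y \<in> down_sets r U"
    using f_down assms unfolding down_sets_def by blast
  then obtain w where w: "w \<in> carrier H" "f w = f x \<inter> f y"
    using f_surj by blast
  moreover have "Lower H {x, y} = {u \<in> carrier H. u \<sqsubseteq> x \<and> u \<sqsubseteq> y}"
    using assms by (auto simp: Lower_def)
  ultimately have "greatest H w (Lower H {x, y})"
    using assms by (auto simp: greatest_def f_le)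
  then show ?thesis
    using w by (metis greatest_closed greatest_unique Lower_closed f_eqD)
qed

lemma least_carrier_iff: "least H s (carrier H) \<longleftrightarrow> s \<in> carrier H \<and> f s = {}"
proof -
  have "{} \<in> down_sets r U"
    by (simp add: down_sets_def)
  then obtain w where w: "w \<in> carrier H" "f w = {}"
    using f_surj by blast
  then have "least H w (carrier H)"
    by (auto simp: least_def f_le)
  then show ?thesis
    using w by (metis least_mem least_unique f_eqD)
qed

lemma greatest_carrier_iff: "greatest H s (carrier H) \<longleftrightarrow> s \<in> carrier H \<and> f s = U"
proof -
  have "U \<in> down_sets r U"
    by (simp add: down_sets_def)
  then obtain w where w: "w \<in> carrier H" "f w = U"
    using f_surj by blast
  then have "greatest H w (carrier H)"
    using f_subset by (auto simp: greatest_def f_le)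
  then show ?thesis
    using w by (metis greatest_mem greatest_unique f_eqD)
qed

sublocale bounded_lattice H
proof unfold_locales
  fix x y assume xy: "x \<in> carrier H" "y \<in> carrier H"
  have "f x \<union> f y \<in> down_sets r U" "f x \<inter> f y \<in> down_sets r U"
    using f_down xy unfolding down_sets_def by blast+
  then show "\<exists>s. least H s (Upper H {x, y})" "\<exists>s. greatest H s (Lower H {x, y})"
    unfolding least_Upper_iff[OF xy] greatest_Lower_iff[OF xy] using f_surj by blast+
next
  have "{} \<in> down_sets r U" "U \<in> down_sets r U"
    by (simp_all add: down_sets_def)
  then show "\<exists>s. least H s (carrier H)" "\<exists>s. greatest H s (carrier H)"
    unfolding least_carrier_iff greatest_carrier_iff using f_surj by blast+
qed

lemma f_bottom: "f \<bottom> = {}"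
  using bottom_least least_carrier_iff by blast

lemma f_top: "f \<top> = U"
  using top_greatest greatest_carrier_iff by blast

text \<open>The join is a chosen least upper bound; existence makes the choice genuine, and
  \<open>least_Upper_iff\<close> then determines its image.\<close>

lemma f_join:
  assumes "x \<in> carrier H" "y \<in> carrier H"
  shows "f (x \<squnion> y) = f x \<union> f y"
  using someI_ex[OF sup_of_two_exists[OF assms]] least_Upper_iff[OF assms]
  unfolding join_def sup_def by blast

lemma f_meet:
  assumes "x \<in> carrier H" "y \<in> carrier H"
  shows "f (x \<sqinter> y) = f x \<inter> f y"
  using someI_ex[OF inf_of_two_exists[OF assms]] greatest_Lower_iff[OF assms]
  unfolding meet_def inf_def by blast

text \<open>The supremum has the form used for \<open>himp\<close> in \<open>dyck_heyting\<close>.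
  By adjointness the set is the principal ideal of the preimage \<open>w\<close> of
  \<open>down_imp\<close>, so its supremum exists and equals \<open>w\<close>.\<close>

lemma pseudo_complement:
  assumes xy: "x \<in> carrier H" "y \<in> carrier H"
  defines "s \<equiv> \<Squnion>{z \<in> carrier H. x \<sqinter> z \<sqsubseteq> y}"
  shows "s \<in> carrier H" "f s = down_imp r U (f x) (f y)"
proof -
  let ?Z = "{z \<in> carrier H. x \<sqinter> z \<sqsubseteq> y}"
  obtain w where w: "w \<in> carrier H" "f w = down_imp r U (f x) (f y)"
    using f_surj down_imp_down by blast
  have Z: "x \<sqinter> z \<sqsubseteq> y \<longleftrightarrow> z \<sqsubseteq> w" if z: "z \<in> carrier H" for z
  proof -
    have "x \<sqinter> z \<sqsubseteq> y \<longleftrightarrow> f x \<inter> f z \<subseteq> f y"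
      using xy z by (simp only: f_le f_meet meet_closed)
    also have "\<dots> \<longleftrightarrow> z \<sqsubseteq> w"
      using z w down_imp_adjoint[OF f_down[OF z]] by (simp only: f_le)
    finally show ?thesis .
  qed
  then have "?Z = {z \<in> carrier H. z \<sqsubseteq> w}"
    by blast
  moreover have "Upper H {z \<in> carrier H. z \<sqsubseteq> w} = {u \<in> carrier H. w \<sqsubseteq> u}"
    using w unfolding Upper_def by (blast intro: le_trans le_refl)
  ultimately have l: "least H w (Upper H ?Z)"
    using w by (simp add: least_def)
  then have "s = w"
    unfolding s_def sup_def by (metis (mono_tags, lifting) someI least_unique)
  then show "s \<in> carrier H" "f s = down_imp r U (f x) (f y)"
    using w by auto
qed

end

section \<open>Heyting operations carried to set operations\<close>

locale heyting_representation = downset_representation r U H f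
  for r :: "'b \<Rightarrow> 'b \<Rightarrow> bool" and U and H :: "'a heyting" (structure) and f +
  assumes hsup_f: "\<lbrakk>x \<in> carrier H; y \<in> carrier H\<rbrakk>
      \<Longrightarrow> hsup H x y \<in> carrier H \<and> f (hsup H x y) = f x \<union> f y"
    and hinf_f: "\<lbrakk>x \<in> carrier H; y \<in> carrier H\<rbrakk>
      \<Longrightarrow> hinf H x y \<in> carrier H \<and> f (hinf H x y) = f x \<inter> f y"
    and himp_f: "\<lbrakk>x \<in> carrier H; y \<in> carrier H\<rbrakk>
      \<Longrightarrow> himp H x y \<in> carrier H \<and> f (himp H x y) = down_imp r U (f x) (f y)"
begin

text \<open>Each operation field has the same image under \<open>f\<close> as the operation derived
  from the order, and \<open>f\<close> is injective.\<close>

lemma heyting_algebra: "heyting_algebra H"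
proof unfold_locales
  fix x y assume xy: "x \<in> carrier H" "y \<in> carrier H"
  show "hsup H x y = x \<squnion> y" "hinf H x y = x \<sqinter> y"
    using xy hsup_f hinf_f by (auto intro!: f_eqD simp: f_join f_meet)
  show "himp H x y \<in> carrier H"
    using xy himp_f by blast
  fix z assume z: "z \<in> carrier H"
  show "x \<sqinter> z \<sqsubseteq> y \<longleftrightarrow> z \<sqsubseteq> himp H x y"
    using xy z himp_f down_imp_adjoint[OF f_down] by (simp add: f_le f_meet)
qed

end

lemma heyting_iso_of_representations:
  assumes A: "heyting_representation r U A f" and B: "heyting_representation r U B g"
  shows "inv_into (carrier B) g \<circ> f \<in> heyting_iso A B"
proof -
  interpret A: heyting_representation r U A f by fact
  interpret B: heyting_representation r U B g by fact
  define h where "h = inv_into (carrier B) g \<circ> f"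
  have bij: "bij_betw h (carrier A) (carrier B)"
    unfolding h_def by (intro bij_betw_trans[OF A.f_bij] bij_betw_inv_into B.f_bij)
  have h: "h x \<in> carrier B" "g (h x) = f x" if "x \<in> carrier A" for x
  proof -
    show "h x \<in> carrier B"
      using bij that by (auto simp: bij_betw_def)
    have "f x \<in> g ` carrier B"
      using A.f_down[OF that] B.f_bij by (simp add: bij_betw_def)
    then show "g (h x) = f x"
      by (simp add: h_def f_inv_into_f)
  qed
  \<comment> \<open>Elements of \<open>B\<close> are identified by their images under
    \<open>g\<close>, so every homomorphism law reduces to an identity between sets.\<close>
  have eqI: "h x = y" if "x \<in> carrier A" "y \<in> carrier B" "f x = g y" for x y
    using that h by (auto intro: B.f_eqD)
  have "h \<in> heyting_hom A B"
    unfolding heyting_hom_def mem_Collect_eq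
  proof (intro conjI ballI)
    show "h \<in> carrier A \<rightarrow> carrier B"
      using h by auto
    show "h \<bottom>\<^bsub>A\<^esub> = \<bottom>\<^bsub>B\<^esub>" "h \<top>\<^bsub>A\<^esub> = \<top>\<^bsub>B\<^esub>"
      by (auto intro!: eqI simp: A.f_bottom B.f_bottom A.f_top B.f_top)
  next
    fix x y assume "x \<in> carrier A" "y \<in> carrier A"
    then show "h (hsup A x y) = hsup B (h x) (h y)" "h (hinf A x y) = hinf B (h x) (h y)"
      "h (himp A x y) = himp B (h x) (h y)"
      by (auto intro!: eqI simp: h A.hsup_f B.hsup_f A.hinf_f B.hinf_f A.himp_f B.himp_f)
  qed
  then show ?thesis
    using bij by (simp add: heyting_iso_def h_def)
qed


section \<open>Index pairs of intervals\<close>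

definition index_pairs :: "nat \<Rightarrow> (nat \<times> nat) set" where
  "index_pairs m = {(i, j). 1 \<le> i \<and> i \<le> j \<and> j \<le> m}"

text \<open>Inclusion of the interval coded by \<open>p\<close> in the one coded by
  \<open>q\<close>, expressed by end points.\<close>

definition nested :: "nat \<times> nat \<Rightarrow> nat \<times> nat \<Rightarrow> bool" where
  "nested p q \<longleftrightarrow> fst q \<le> fst p \<and> snd p \<le> snd q"

lemma finite_index_pairs: "finite (index_pairs m)"
  by (rule finite_subset[of _ "{..m} \<times> {..m}"]) (auto simp: index_pairs_def)

lemma nested_refl: "nested p p"
  by (simp add: nested_def)

lemma nested_trans: "nested p q \<Longrightarrow> nested q s \<Longrightarrow> nested p s"
  by (auto simp: nested_def)


section \<open>Dyck paths as down-sets of pairs\<close>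

lemma height_0 [simp]: "height P 0 = 0"
  by (simp add: height_def)

lemma height_Suc: "k < length P \<Longrightarrow> height P (Suc k) = height P k + rise (P ! k)"
  by (simp add: height_def take_Suc_conv_app_nth)

lemma rise_cases: "rise s = 1 \<or> rise s = - 1"
  by (cases s) auto

lemma rise_inj: "rise s = rise s' \<Longrightarrow> s = s'"
  by (cases s; cases s') auto

text \<open>Every step changes both the abscissa and the height by an odd amount.\<close>

lemma even_height_add: "k \<le> length P \<Longrightarrow> even (height P k + int k)"
proof (induction k)
  case (Suc k)
  then show ?case
    using rise_cases[of "P ! k"] by (auto simp: height_Suc)
qed simp

lemma height_diff:
  assumes "k + d \<le> length P"
  shows "\<bar>height P (k + d) - height P k\<bar> \<le> int d"
  using assms
proof (induction d)
  case (Suc d)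
  then show ?case
    using rise_cases[of "P ! (k + d)"] by (auto simp: height_Suc)
qed simp

lemma height_Lipschitz:
  assumes "k \<le> length P" "l \<le> length P"
  shows "height P k - \<bar>int l - int k\<bar> \<le> height P l"
proof (cases "k \<le> l")
  case True
  then show ?thesis
    using height_diff[of k "l - k" P] assms by auto
next
  case False
  then show ?thesis
    using height_diff[of l "k - l" P] assms by auto
qed

lemma path_eqI:
  assumes "length P = length Q" "\<And>k. k \<le> length P \<Longrightarrow> height P k = height Q k"
  shows "P = Q"
proof (rule nth_equalityI)
  fix k assume k: "k < length P"
  then have "height P (Suc k) = height Q (Suc k)" "height P k = height Q k"
    using assms(2) by auto
  then have "rise (P ! k) = rise (Q ! k)"
    using k assms(1) by (simp add: height_Suc)
  then show "P ! k = Q ! k"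
    by (rule rise_inj)
qed fact

text \<open>The path goes up exactly where \<open>h\<close> increases; increments of absolute value
  1 leave only a descent elsewhere.\<close>

lemma path_with_heights:
  fixes h :: "nat \<Rightarrow> int"
  assumes "h 0 = 0" "\<And>k. k < N \<Longrightarrow> \<bar>h (Suc k) - h k\<bar> = 1"
  shows "\<exists>P. length P = N \<and> (\<forall>k\<le>N. height P k = h k)"
proof -
  define P where "P = map (\<lambda>k. if h (Suc k) > h k then Up else Down) [0..<N]"
  have len: "length P = N"
    by (simp add: P_def)
  have "height P k = h k" if "k \<le> N" for k
    using that
  proof (induction k)
    case 0
    then show ?case
      using assms(1) by simp
  next
    case (Suc k)
    then have "rise (P ! k) = h (Suc k) - h k"
      using assms(2)[of k] by (auto simp: P_def)
    then show ?case
      using Suc len by (simp add: height_Suc)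
  qed
  then show ?thesis
    using len by blast
qed

text \<open>The pair \<open>(i, j)\<close> stands for the lattice point \<open>(i + j, j - i + 2)\<close>. These points are exactly
  those which lie strictly above the lowest path \<open>UDUD\<dots>\<close>, are of the parity attained by paths, and
  lie weakly below the highest path.\<close>

definition pairs_below :: "nat \<Rightarrow> step list \<Rightarrow> (nat \<times> nat) set" where
  "pairs_below n P = {(i, j) \<in> index_pairs (n - 1). int j - int i + 2 \<le> height P (i + j)}"

text \<open>Shrinking an interval by \<open>a\<close> on the left and \<open>b\<close> on the right
  moves its point horizontally by \<open>\<bar>a - b\<bar>\<close> and lowers it by
  \<open>a + b\<close>, which is at least as much as a path can descend over that distance.\<close>

lemma pairs_below_down_set:
  assumes "P \<in> dyck_paths n"
  shows "pairs_below n P \<in> down_sets nested (index_pairs (n - 1))"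
  unfolding down_sets_def mem_Collect_eq
proof (intro conjI ballI impI)
  show "pairs_below n P \<subseteq> index_pairs (n - 1)"
    by (auto simp: pairs_below_def)
next
  fix p q
  assume pq: "p \<in> pairs_below n P" "q \<in> index_pairs (n - 1)" "nested q p"
  obtain i j i' j' where [simp]: "p = (i, j)" "q = (i', j')"
    by (metis surj_pair)
  have "i + j \<le> length P" "i' + j' \<le> length P"
    using pq assms by (auto simp: pairs_below_def index_pairs_def dyck_paths_def)
  then have "height P (i + j) - \<bar>int (i' + j') - int (i + j)\<bar> \<le> height P (i' + j')"
    by (rule height_Lipschitz)
  then show "q \<in> pairs_below n P"
    using pq by (auto simp: pairs_below_def nested_def)
qed

text \<open>A vertex of \<open>P\<close> of height at least 2 is itself the point of a pair, hence
  lies weakly below \<open>Q\<close>. Lower vertices are handled by parity.\<close>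

lemma height_le_iff_pairs_below:
  assumes P: "P \<in> dyck_paths n" and Q: "Q \<in> dyck_paths n"
  shows "(\<forall>k\<le>2 * n. height P k \<le> height Q k) \<longleftrightarrow> pairs_below n P \<subseteq> pairs_below n Q"
proof
  assume "\<forall>k\<le>2 * n. height P k \<le> height Q k"
  then have "height P (i + j) \<le> height Q (i + j)" if "(i, j) \<in> index_pairs (n - 1)" for i j
    using that by (auto simp: index_pairs_def)
  then show "pairs_below n P \<subseteq> pairs_below n Q"
    unfolding pairs_below_def by force
next
  assume sub: "pairs_below n P \<subseteq> pairs_below n Q"
  show "\<forall>k\<le>2 * n. height P k \<le> height Q k"
  proof (intro allI impI)
    fix k assume k: "k \<le> 2 * n"
    have len: "length P = 2 * n" "length Q = 2 * n"
      and Q0: "0 \<le> height Q k" and Pn: "height P (2 * n) = 0"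
      using P Q k by (auto simp: dyck_paths_def)
    have even: "even (height P k + int k)" "even (height Q k + int k)"
      using even_height_add k len by auto
    show "height P k \<le> height Q k"
    proof (cases "height P k \<le> 1")
      case True
      \<comment> \<open>Both heights have the parity of \<open>k\<close>; if that of
        \<open>P\<close> is 1, the nonnegative height of \<open>Q\<close> is odd and so at least
        1.\<close>
      then show ?thesis
        using Q0 even by presburger
    next
      case False
      \<comment> \<open>The slope bounds from the two ends of the path amount to
        \<open>c \<le> k\<close> and \<open>c \<le> n\<close>, that is, \<open>1 \<le> i\<close> and
        \<open>j \<le> n - 1\<close>. The numbers \<open>i\<close> and \<open>j\<close> solve
        \<open>i + j = k\<close> and \<open>j - i + 2 = height P k\<close>; height at least 2 gives
        \<open>i \<le> j\<close>.\<close>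
      have "height P k \<le> int k" "height P k \<le> 2 * int n - int k"
        using height_Lipschitz[of k P 0] height_Lipschitz[of k P "2 * n"] k len Pn by auto
      moreover obtain c where c: "height P k + int k = 2 * c"
        using even by (elim evenE)
      moreover define i j where "i = nat (int k - c + 1)" and "j = nat (c - 1)"
      ultimately have "(i, j) \<in> index_pairs (n - 1)" "i + j = k" "int j - int i + 2 = height P k"
        using False by (auto simp: index_pairs_def)
      then show ?thesis
        using sub by (auto simp: pairs_below_def)
    qed
  qed
qed

text \<open>The maximal heights, subject to parity, of the points belonging to a down-set form a path.\<close>

lemma pairs_below_surj:
  assumes D: "D \<in> down_sets nested (index_pairs (n - 1))"
  shows "\<exists>P\<in>dyck_paths n. pairs_below n P = D"
proof -
  \<comment> \<open>The inserted value \<open>k mod 2\<close> is the height of the lowest path at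
    \<open>k\<close>; it keeps \<open>S k\<close> nonempty.\<close>
  define S where "S k = insert (int (k mod 2)) ((\<lambda>(i, j). int j - int i + 2) ` {(i, j) \<in> D. i + j = k})"
    for k
  define h where "h k = Max (S k)" for k
  have sub: "D \<subseteq> index_pairs (n - 1)"
    using D by (simp add: down_sets_def)
  have down: "q \<in> D" if "p \<in> D" "q \<in> index_pairs (n - 1)" "nested q p" for p q
    using D that by (auto simp: down_sets_def)
  have fin: "finite (S k)" for k
    unfolding S_def using finite_subset[OF sub finite_index_pairs]
    by (auto intro: finite_subset[of _ D])
  have h_mod: "int (k mod 2) \<le> h k" for k
    unfolding h_def by (rule Max_ge[OF fin]) (simp add: S_def)
  have h_ge: "int j - int i + 2 \<le> h (i + j)" if "(i, j) \<in> D" for i j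
    unfolding h_def by (rule Max_ge[OF fin]) (use that in \<open>force simp: S_def\<close>)
  have h_cases: "h k = int (k mod 2) \<or> (\<exists>i j. (i, j) \<in> D \<and> i + j = k \<and> h k = int j - int i + 2)" for k
  proof -
    have "h k \<in> S k"
      unfolding h_def by (rule Max_in[OF fin]) (simp add: S_def)
    then show ?thesis
      by (auto simp: S_def)
  qed
  have h_even: "even (h k + int k)" for k
    using h_cases[of k]
  proof (elim disjE exE conjE)
    assume "h k = int (k mod 2)"
    then show ?thesis
      by presburger
  next
    fix i j assume "i + j = k" "h k = int j - int i + 2"
    then have "h k + int k = 2 * (int j + 1)"
      by auto
    then show ?thesis
      by simp
  qed
  \<comment> \<open>If \<open>(i, j)\<close> attains \<open>h k\<close> and \<open>i < j\<close>,
    then \<open>(Suc i, j)\<close> gives a point one unit to the right and one lower. If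
    \<open>i = j\<close>, then \<open>h k = 2\<close> with \<open>k\<close> even, and the default
    value 1 at \<open>Suc k\<close> suffices.\<close>
  have down_step: "h k \<le> h (Suc k) + 1" for k
    using h_cases[of k]
  proof (elim disjE exE conjE)
    assume "h k = int (k mod 2)"
    then show ?thesis
      using h_mod[of "Suc k"] by linarith
  next
    fix i j assume ij: "(i, j) \<in> D" "i + j = k" "h k = int j - int i + 2"
    show ?thesis
    proof (cases "i = j")
      case True
      then show ?thesis
        using ij h_mod[of "Suc k"] by presburger
    next
      case False
      then have "(Suc i, j) \<in> D"
        using ij sub by (intro down[OF ij(1)]) (auto simp: index_pairs_def nested_def)
      then show ?thesis
        using h_ge[of "Suc i" j] ij by auto
    qed
  qed
  \<comment> \<open>The mirror image: the right end point of the interval is removed instead of the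
    left one.\<close>
  have up_step: "h (Suc k) \<le> h k + 1" for k
    using h_cases[of "Suc k"]
  proof (elim disjE exE conjE)
    assume "h (Suc k) = int (Suc k mod 2)"
    then show ?thesis
      using h_mod[of k] by linarith
  next
    fix i j assume ij: "(i, j) \<in> D" "i + j = Suc k" "h (Suc k) = int j - int i + 2"
    show ?thesis
    proof (cases "i = j")
      case True
      then show ?thesis
        using ij h_mod[of k] by presburger
    next
      case False
      then have j: "i \<le> j - 1" "j \<ge> 1"
        using ij sub by (auto simp: index_pairs_def)
      then have "(i, j - 1) \<in> D"
        using ij sub by (intro down[OF ij(1)]) (auto simp: index_pairs_def nested_def)
      moreover have "i + (j - 1) = k"
        using ij j by simp
      ultimately show ?thesis
        using h_ge[of i "j - 1"] ij j by auto
    qed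
  qed
  \<comment> \<open>Pairs in \<open>D\<close> have sums between 2 and \<open>2 * (n - 1)\<close>, so
    only the default value 0 is available at both ends.\<close>
  have h_end: "h k = 0" if "k = 0 \<or> k = 2 * n" for k
    using h_cases[of k] that sub by (auto simp: index_pairs_def)
  have "\<bar>h (Suc k) - h k\<bar> = 1" for k
  proof -
    \<comment> \<open>Parity excludes a horizontal step, and the two one-sided bounds exclude steps
      larger than 1.\<close>
    have "odd (h (Suc k) - h k)"
      using h_even[of k] h_even[of "Suc k"] by presburger
    then have "h (Suc k) \<noteq> h k"
      by auto
    then show ?thesis
      using up_step[of k] down_step[of k] by linarith
  qed
  then obtain P where P: "length P = 2 * n" "\<And>k. k \<le> 2 * n \<Longrightarrow> height P k = h k"
    using path_with_heights[of h "2 * n"] h_end by blast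
  have "0 \<le> h k" for k
    using h_mod[of k] by linarith
  then have "P \<in> dyck_paths n"
    using P h_end by (auto simp: dyck_paths_def)
  moreover have "(i, j) \<in> pairs_below n P \<longleftrightarrow> (i, j) \<in> D" for i j
  proof
    assume ij: "(i, j) \<in> pairs_below n P"
    then have U: "(i, j) \<in> index_pairs (n - 1)" and "int j - int i + 2 \<le> h (i + j)" "i \<le> j"
      using P by (auto simp: pairs_below_def index_pairs_def)
    \<comment> \<open>Here \<open>h (i + j)\<close> is at least 2, so it is not the default value
      but comes from a pair of \<open>D\<close>. With equal sum and no smaller difference, that pair
      codes an interval containing \<open>[i, j]\<close>.\<close>
    then obtain i' j' where "(i', j') \<in> D" "i' + j' = i + j" "int j - int i \<le> int j' - int i'"
      using h_cases[of "i + j"] by auto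
    moreover from this have "i' \<le> i" "j \<le> j'"
      by linarith+
    ultimately show "(i, j) \<in> D"
      by (intro down[OF _ U, of "(i', j')"]) (simp_all add: nested_def)
  next
    assume ij: "(i, j) \<in> D"
    then have U: "(i, j) \<in> index_pairs (n - 1)"
      using sub by blast
    then have "height P (i + j) = h (i + j)"
      by (intro P) (auto simp: index_pairs_def)
    then show "(i, j) \<in> pairs_below n P"
      using U h_ge[OF ij] by (simp add: pairs_below_def)
  qed
  then have "pairs_below n P = D"
    by auto
  ultimately show ?thesis
    by blast
qed

section \<open>Representation of the order and Heyting algebra of Dyck paths\<close>

lemma dyck_order_representation:
  "downset_representation nested (index_pairs (n - 1)) (dyck_order n) (pairs_below n)"
proof
  show "bij_betw (pairs_below n) (carrier (dyck_order n)) (down_sets nested (index_pairs (n - 1)))"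
    unfolding bij_betw_def
  proof (intro conjI inj_onI)
    fix P Q assume "P \<in> carrier (dyck_order n)" "Q \<in> carrier (dyck_order n)"
      and eq: "pairs_below n P = pairs_below n Q"
    then have P: "P \<in> dyck_paths n" and Q: "Q \<in> dyck_paths n"
      by (auto simp: dyck_order_def)
    then have "height P k = height Q k" if "k \<le> 2 * n" for k
      using height_le_iff_pairs_below[OF P Q] height_le_iff_pairs_below[OF Q P] eq that
      by (auto intro: antisym)
    then show "P = Q"
      using P Q by (intro path_eqI) (auto simp: dyck_paths_def)
  next
    show "pairs_below n ` carrier (dyck_order n) = down_sets nested (index_pairs (n - 1))"
      using pairs_below_surj[of _ n] pairs_below_down_set[of _ n]
      by (auto simp: dyck_order_def simp del: One_nat_def)
  qed
next
  show "nested p s" if "nested p q" "nested q s" for p q s :: "nat \<times> nat"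
    using that by (rule nested_trans)
qed (simp_all add: nested_refl dyck_order_def height_le_iff_pairs_below)

text \<open>The operations of \<open>dyck_heyting\<close> are computed in \<open>dyck_order\<close>,
  so their images come from the representation of that order.\<close>

lemma dyck_heyting_representation:
  "heyting_representation nested (index_pairs (n - 1)) (dyck_heyting n) (pairs_below n)"
proof -
  interpret D: downset_representation nested "index_pairs (n - 1)" "dyck_order n" "pairs_below n"
    by (rule dyck_order_representation)
  have carrier: "carrier (dyck_heyting n) = carrier (dyck_order n)"
    and le: "le (dyck_heyting n) = le (dyck_order n)"
    by (simp_all add: dyck_heyting_def)
  show ?thesis
  proof (unfold_locales, unfold carrier le)
    show "nested p p" for p
      by (rule nested_refl)
    show "nested p s" if "nested p q" "nested q s" for p q s :: "nat \<times> nat"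
      using that by (rule nested_trans)
    show "eq (dyck_heyting n) = (=)"
      by (simp add: dyck_heyting_def)
    show "bij_betw (pairs_below n) (carrier (dyck_order n)) (down_sets nested (index_pairs (n - 1)))"
      by (rule D.f_bij)
  next
    fix P Q assume PQ: "P \<in> carrier (dyck_order n)" "Q \<in> carrier (dyck_order n)"
    show "le (dyck_order n) P Q \<longleftrightarrow> pairs_below n P \<subseteq> pairs_below n Q"
      using PQ by (rule D.f_le)
    show "hsup (dyck_heyting n) P Q \<in> carrier (dyck_order n) \<and>
        pairs_below n (hsup (dyck_heyting n) P Q) = pairs_below n P \<union> pairs_below n Q"
      using PQ by (simp add: dyck_heyting_def D.f_join)
    show "hinf (dyck_heyting n) P Q \<in> carrier (dyck_order n) \<and>
        pairs_below n (hinf (dyck_heyting n) P Q) = pairs_below n P \<inter> pairs_below n Q"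
      using PQ by (simp add: dyck_heyting_def D.f_meet)
    show "himp (dyck_heyting n) P Q \<in> carrier (dyck_order n) \<and>
        pairs_below n (himp (dyck_heyting n) P Q) =
          down_imp nested (index_pairs (n - 1)) (pairs_below n P) (pairs_below n Q)"
      using D.pseudo_complement[OF PQ] by (simp add: dyck_heyting_def)
  qed
qed


section \<open>Equivalence classes of propositions as down-sets of pairs\<close>

locale time_line =
  fixes t :: "nat \<Rightarrow> 'a::linorder" and m :: nat
  assumes t_mono: "strict_mono_on {1..m} t"
begin

text \<open>An image of an index interval; it agrees with the sets in \<open>intervals\<close>
  because \<open>t\<close> is strictly increasing on \<open>{1..m}\<close>.\<close>

definition pair_interval :: "nat \<times> nat \<Rightarrow> 'a set" where
  "pair_interval p = t ` {fst p..snd p}"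

definition truth_set :: "itl \<Rightarrow> (nat \<times> nat) set" where
  "truth_set \<phi> = {p \<in> index_pairs m. holds t m \<phi> (pair_interval p)}"

lemma t_inj: "inj_on t {1..m}"
  using t_mono by (rule strict_mono_on_imp_inj_on)

lemma t_le_iff: "\<lbrakk>i \<in> {1..m}; j \<in> {1..m}\<rbrakk> \<Longrightarrow> t i \<le> t j \<longleftrightarrow> i \<le> j"
  using t_mono by (rule strict_mono_on_less_eq)

lemma intervals_eq: "intervals t m = pair_interval ` index_pairs m"
proof -
  have interval: "{x \<in> t ` {1..m}. t i \<le> x \<and> x \<le> t j} = pair_interval (i, j)"
    if "1 \<le> i \<and> i \<le> j \<and> j \<le> m" for i j
    using that by (auto simp: pair_interval_def t_le_iff)
  have "intervals t m = {pair_interval (i, j) | i j. 1 \<le> i \<and> i \<le> j \<and> j \<le> m}"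
    unfolding intervals_def using interval by (intro Collect_cong ex_cong1) blast
  also have "\<dots> = pair_interval ` index_pairs m"
    by (auto simp: index_pairs_def)
  finally show ?thesis .
qed

text \<open>Injectivity of \<open>t\<close> reduces the inclusion to index intervals; as the smaller
  one is nonempty, it is then a comparison of end points.\<close>

lemma pair_interval_subset_iff:
  assumes "p \<in> index_pairs m" "q \<in> index_pairs m"
  shows "pair_interval p \<subseteq> pair_interval q \<longleftrightarrow> nested p q"
proof -
  have pq: "{fst p..snd p} \<subseteq> {1..m}" "{fst q..snd q} \<subseteq> {1..m}" "fst p \<le> snd p"
    using assms by (auto simp: index_pairs_def)
  then have "t k \<in> t ` {fst q..snd q} \<longleftrightarrow> k \<in> {fst q..snd q}" if "k \<in> {fst p..snd p}" for k
    using that by (intro inj_on_image_mem_iff[OF t_inj]) auto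
  then have "pair_interval p \<subseteq> pair_interval q \<longleftrightarrow> {fst p..snd p} \<subseteq> {fst q..snd q}"
    unfolding pair_interval_def image_subset_iff subset_iff[of "{fst p..snd p}"] by blast
  then show ?thesis
    using pq by (auto simp: nested_def)
qed

text \<open>Quantification over subintervals becomes quantification over nested pairs; in particular
  \<open>Cond\<close> becomes the implication of down-sets.\<close>

lemma truth_set_connectives:
  "truth_set Fls = {}"
  "truth_set (Or \<phi> \<psi>) = truth_set \<phi> \<union> truth_set \<psi>"
  "truth_set (And \<phi> \<psi>) = truth_set \<phi> \<inter> truth_set \<psi>"
  "truth_set (Sim \<phi>) = {p \<in> index_pairs m. \<forall>q\<in>index_pairs m. nested q p \<longrightarrow> q \<notin> truth_set \<phi>}"
  "truth_set (Cond \<phi> \<psi>) = down_imp nested (index_pairs m) (truth_set \<phi>) (truth_set \<psi>)"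
proof -
  have sub: "(\<forall>J\<in>intervals t m. J \<subseteq> pair_interval p \<longrightarrow> R J) \<longleftrightarrow>
      (\<forall>q\<in>index_pairs m. nested q p \<longrightarrow> R (pair_interval q))"
    if "p \<in> index_pairs m" for R p
    using that by (simp add: intervals_eq pair_interval_subset_iff)
  show "truth_set Fls = {}"
    "truth_set (Or \<phi> \<psi>) = truth_set \<phi> \<union> truth_set \<psi>"
    "truth_set (And \<phi> \<psi>) = truth_set \<phi> \<inter> truth_set \<psi>"
    by (auto simp: truth_set_def)
  show "truth_set (Sim \<phi>) = {p \<in> index_pairs m. \<forall>q\<in>index_pairs m. nested q p \<longrightarrow> q \<notin> truth_set \<phi>}"
    by (simp add: truth_set_def sub cong: conj_cong)
  show "truth_set (Cond \<phi> \<psi>) = down_imp nested (index_pairs m) (truth_set \<phi>) (truth_set \<psi>)"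
    by (simp add: truth_set_def sub down_imp_def cong: conj_cong)
qed

lemma truth_set_Eps:
  assumes "k \<in> {1..m}"
  shows "truth_set (Eps k) = {(k, k)}"
proof -
  have kk: "(k, k) \<in> index_pairs m" and kk': "pair_interval (k, k) = {t k}"
    using assms by (auto simp: index_pairs_def pair_interval_def)
  have "p = (k, k)" if "p \<in> index_pairs m" "pair_interval p = {t k}" for p
  proof -
    have "nested p (k, k)"
      using that pair_interval_subset_iff[OF that(1) kk] kk' by simp
    then show ?thesis
      using that(1) by (auto simp: nested_def index_pairs_def)
  qed
  moreover have "truth_set (Eps k) = {p \<in> index_pairs m. pair_interval p = {t k}}"
    by (simp add: truth_set_def)
  ultimately show ?thesis
    using kk kk' by blast
qed

lemma Theta_iff:
  "\<phi> \<in> Theta t m \<longleftrightarrow> \<phi> \<in> ITL m \<and> truth_set \<phi> \<in> down_sets nested (index_pairs m)"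
  by (auto simp: Theta_def valid_def intervals_eq down_sets_def truth_set_def
      pair_interval_subset_iff)

lemma truth_set_eq_iff:
  "truth_set \<phi> = truth_set \<psi> \<longleftrightarrow> (\<forall>I\<in>intervals t m. holds t m \<phi> I = holds t m \<psi> I)"
  by (auto simp: intervals_eq truth_set_def)

lemma truth_set_le_iff:
  "truth_set \<phi> \<subseteq> truth_set \<psi> \<longleftrightarrow> (\<forall>I\<in>intervals t m. holds t m \<phi> I \<le> holds t m \<psi> I)"
  by (auto simp: intervals_eq truth_set_def)

text \<open>The principal down-set of \<open>(i, j)\<close> is defined by forbidding all subintervals \<open>{t k}\<close> with \<open>k\<close>
  outside \<open>{i..j}\<close>.\<close>

lemma principal_definable:
  assumes "p \<in> index_pairs m"
  shows "\<exists>\<phi>\<in>ITL m. truth_set \<phi> = {q \<in> index_pairs m. nested q p}"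
proof -
  \<comment> \<open>A finite set \<open>K\<close> of forbidden points is expressed by the
    disjunction of the \<open>Eps k\<close>, starting from \<open>Fls\<close>.\<close>
  have "\<exists>\<phi>\<in>ITL m. truth_set \<phi> = (\<lambda>k. (k, k)) ` K" if "finite K" "K \<subseteq> {1..m}" for K
    using that
  proof induction
    case empty
    have "Fls \<in> ITL m"
      by (simp add: ITL_def)
    then show ?case
      by (intro bexI[of _ Fls]) (simp_all add: truth_set_connectives)
  next
    case (insert k K)
    then obtain \<phi> where "\<phi> \<in> ITL m" "truth_set \<phi> = (\<lambda>k. (k, k)) ` K"
      by auto
    then have "Or (Eps k) \<phi> \<in> ITL m" "truth_set (Or (Eps k) \<phi>) = (\<lambda>k. (k, k)) ` insert k K"
      using insert.prems by (auto simp: ITL_def truth_set_connectives truth_set_Eps)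
    then show ?case
      by blast
  qed
  then obtain \<phi> where \<phi>: "\<phi> \<in> ITL m"
      "truth_set \<phi> = (\<lambda>k. (k, k)) ` ({1..m} - {fst p..snd p})"
    by (metis Diff_subset finite_Diff finite_atLeastAtMost)
  have "(\<forall>q'\<in>index_pairs m. nested q' q \<longrightarrow> q' \<notin> truth_set \<phi>) \<longleftrightarrow> nested q p"
    if q: "q \<in> index_pairs m" for q
  proof
    assume none: "\<forall>q'\<in>index_pairs m. nested q' q \<longrightarrow> q' \<notin> truth_set \<phi>"
    have "k \<in> {fst p..snd p}" if "k \<in> {fst q..snd q}" for k
    proof (rule ccontr)
      assume "k \<notin> {fst p..snd p}"
      moreover have "k \<in> {1..m}"
        using that q by (auto simp: index_pairs_def)
      ultimately have "(k, k) \<in> truth_set \<phi>"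
        using \<phi>(2) by blast
      moreover have "(k, k) \<in> index_pairs m" "nested (k, k) q"
        using that \<open>k \<in> {1..m}\<close> by (auto simp: index_pairs_def nested_def)
      ultimately show False
        using none by blast
    qed
    \<comment> \<open>Both end points of \<open>q\<close> lie in \<open>{fst p..snd p}\<close>,
      which is exactly nestedness.\<close>
    from this[of "fst q"] this[of "snd q"] show "nested q p"
      using q by (auto simp: index_pairs_def nested_def)
  next
    assume "nested q p"
    then show "\<forall>q'\<in>index_pairs m. nested q' q \<longrightarrow> q' \<notin> truth_set \<phi>"
      unfolding \<phi>(2) by (auto simp: nested_def)
  qed
  then have "truth_set (Sim \<phi>) = {q \<in> index_pairs m. nested q p}"
    unfolding truth_set_connectives by blast
  moreover have "Sim \<phi> \<in> ITL m"
    using \<phi> by (simp add: ITL_def)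
  ultimately show ?thesis
    by blast
qed

lemma down_set_definable:
  assumes D: "D \<in> down_sets nested (index_pairs m)"
  shows "\<exists>\<phi>\<in>Theta t m. truth_set \<phi> = D"
proof -
  have sub: "D \<subseteq> index_pairs m"
    using D by (simp add: down_sets_def)
  \<comment> \<open>The induction tracks only membership in \<open>ITL m\<close>; that in
    \<open>Theta t m\<close> follows at the end from \<open>Theta_iff\<close>, since
    \<open>D\<close> is a down-set.\<close>
  have union: "\<exists>\<phi>\<in>ITL m. truth_set \<phi> = (\<Union>p\<in>S. {q \<in> index_pairs m. nested q p})"
    if "finite S" "S \<subseteq> index_pairs m" for S
    using that
  proof induction
    case empty
    have "Fls \<in> ITL m"
      by (simp add: ITL_def)
    then show ?case
      by (intro bexI[of _ Fls]) (simp_all add: truth_set_connectives)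
  next
    case (insert p S)
    then obtain \<phi> \<psi> where "\<phi> \<in> ITL m" "truth_set \<phi> = (\<Union>p\<in>S. {q \<in> index_pairs m. nested q p})"
      "\<psi> \<in> ITL m" "truth_set \<psi> = {q \<in> index_pairs m. nested q p}"
      using principal_definable[of p] by auto
    then have "Or \<psi> \<phi> \<in> ITL m"
      "truth_set (Or \<psi> \<phi>) = (\<Union>p\<in>insert p S. {q \<in> index_pairs m. nested q p})"
      by (auto simp: ITL_def truth_set_connectives)
    then show ?case
      by blast
  qed
  from union[OF finite_subset[OF sub finite_index_pairs] sub]
  obtain \<phi> where "\<phi> \<in> ITL m" "truth_set \<phi> = (\<Union>p\<in>D. {q \<in> index_pairs m. nested q p})" ..
  moreover have "(\<Union>p\<in>D. {q \<in> index_pairs m. nested q p}) = D"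
  proof
    show "(\<Union>p\<in>D. {q \<in> index_pairs m. nested q p}) \<subseteq> D"
      using D by (auto simp: down_sets_def)
    show "D \<subseteq> (\<Union>p\<in>D. {q \<in> index_pairs m. nested q p})"
      using sub nested_refl by fast
  qed
  ultimately show ?thesis
    using D Theta_iff by auto
qed

text \<open>All members of a class share one truth set, so the union returns it without choosing a
  representative.\<close>

definition class_truth :: "itl set \<Rightarrow> (nat \<times> nat) set" where
  "class_truth A = (\<Union>\<phi>\<in>A. truth_set \<phi>)"

lemma theta_rel_iff:
  "(\<phi>, \<psi>) \<in> theta_rel t m \<longleftrightarrow> \<phi> \<in> Theta t m \<and> \<psi> \<in> Theta t m \<and> truth_set \<phi> = truth_set \<psi>"
  by (simp add: theta_rel_def truth_set_eq_iff)

lemma mem_classes_iff: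
  "A \<in> Theta t m // theta_rel t m \<longleftrightarrow>
    (\<exists>\<phi>\<in>Theta t m. A = {\<psi> \<in> Theta t m. truth_set \<psi> = truth_set \<phi>})"
proof -
  have "theta_rel t m `` {\<phi>} = {\<psi> \<in> Theta t m. truth_set \<psi> = truth_set \<phi>}"
    if "\<phi> \<in> Theta t m" for \<phi>
    using that by (auto simp: theta_rel_iff)
  then show ?thesis
    by (auto simp: quotient_def)
qed

lemma class_eq:
  assumes "A \<in> Theta t m // theta_rel t m"
  shows "A = {\<psi> \<in> Theta t m. truth_set \<psi> = class_truth A}" "A \<noteq> {}"
  using assms by (auto simp: mem_classes_iff class_truth_def)

text \<open>Definability of \<open>D\<close> supplies a representative, so the set is a genuine
  equivalence class.\<close>

lemma class_of_down_set:
  assumes "D \<in> down_sets nested (index_pairs m)"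
  shows "{\<psi> \<in> Theta t m. truth_set \<psi> = D} \<in> Theta t m // theta_rel t m"
    "class_truth {\<psi> \<in> Theta t m. truth_set \<psi> = D} = D"
proof -
  obtain \<phi> where "\<phi> \<in> Theta t m" "truth_set \<phi> = D"
    using down_set_definable[OF assms] by blast
  then show "{\<psi> \<in> Theta t m. truth_set \<psi> = D} \<in> Theta t m // theta_rel t m"
    "class_truth {\<psi> \<in> Theta t m. truth_set \<psi> = D} = D"
    unfolding mem_classes_iff class_truth_def by blast+
qed

lemma class_truth_down_set:
  assumes "A \<in> Theta t m // theta_rel t m"
  shows "class_truth A \<in> down_sets nested (index_pairs m)"
proof -
  obtain \<phi> where "\<phi> \<in> A"
    using class_eq(2)[OF assms] by blast
  then have "\<phi> \<in> Theta t m" "truth_set \<phi> = class_truth A"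
    using class_eq(1)[OF assms] by blast+
  then show ?thesis
    by (simp add: Theta_iff)
qed

text \<open>\<open>class_op\<close> is a union over all pairs of representatives. Each pair
  contributes the same class, because the truth set of \<open>c \<phi> \<psi>\<close> depends only
  on the two truth sets; as \<open>A\<close> and \<open>B\<close> are nonempty, the union is that
  class.\<close>

lemma class_op_truth:
  assumes A: "A \<in> Theta t m // theta_rel t m" and B: "B \<in> Theta t m // theta_rel t m"
    and c_closed: "\<And>\<phi> \<psi>. \<lbrakk>\<phi> \<in> ITL m; \<psi> \<in> ITL m\<rbrakk> \<Longrightarrow> c \<phi> \<psi> \<in> ITL m"
    and c_truth: "\<And>\<phi> \<psi>. truth_set (c \<phi> \<psi>) = F (truth_set \<phi>) (truth_set \<psi>)"
    and F_down: "F (class_truth A) (class_truth B) \<in> down_sets nested (index_pairs m)"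
  shows "class_op t m c A B \<in> Theta t m // theta_rel t m
    \<and> class_truth (class_op t m c A B) = F (class_truth A) (class_truth B)"
proof -
  let ?C = "{\<chi> \<in> Theta t m. truth_set \<chi> = F (class_truth A) (class_truth B)}"
  have "theta_rel t m `` {c \<phi> \<psi>} = ?C" if "\<phi> \<in> A" "\<psi> \<in> B" for \<phi> \<psi>
  proof -
    have "\<phi> \<in> ITL m" "\<psi> \<in> ITL m" "truth_set \<phi> = class_truth A" "truth_set \<psi> = class_truth B"
      using that class_eq(1)[OF A] class_eq(1)[OF B] Theta_iff[THEN iffD1] by blast+
    then show ?thesis
      using F_down by (auto simp: theta_rel_iff Theta_iff c_closed c_truth)
  qed
  then have "class_op t m c A B = ?C"
    using class_eq(2)[OF A] class_eq(2)[OF B] by (simp add: class_op_def)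
  then show ?thesis
    using class_of_down_set[OF F_down] by simp
qed

lemma theta_heyting_representation:
  "heyting_representation nested (index_pairs m) (theta_heyting t m) class_truth"
proof
  show "nested p s" if "nested p q" "nested q s" for p q s :: "nat \<times> nat"
    using that by (rule nested_trans)
next
  show "bij_betw class_truth (carrier (theta_heyting t m)) (down_sets nested (index_pairs m))"
    by (rule bij_betw_byWitness[where f' = "\<lambda>D. {\<psi> \<in> Theta t m. truth_set \<psi> = D}"])
      (auto simp: theta_heyting_def class_of_down_set class_truth_down_set class_eq(1)[symmetric])
next
  fix A B assume "A \<in> carrier (theta_heyting t m)" "B \<in> carrier (theta_heyting t m)"
  then have A: "A \<in> Theta t m // theta_rel t m" and B: "B \<in> Theta t m // theta_rel t m"
    by (auto simp: theta_heyting_def)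
  have "le (theta_heyting t m) A B \<longleftrightarrow> (\<forall>\<phi>\<in>A. \<forall>\<psi>\<in>B. truth_set \<phi> \<subseteq> truth_set \<psi>)"
    by (simp add: theta_heyting_def truth_set_le_iff)
  \<comment> \<open>The order quantifies over all representatives; truth sets are constant on the
    nonempty classes \<open>A\<close> and \<open>B\<close>, so one comparison decides it.\<close>
  also have "\<dots> \<longleftrightarrow> class_truth A \<subseteq> class_truth B"
    using class_eq[OF A] class_eq[OF B] by blast
  finally show "le (theta_heyting t m) A B \<longleftrightarrow> class_truth A \<subseteq> class_truth B" .
  have "class_truth A \<union> class_truth B \<in> down_sets nested (index_pairs m)"
    "class_truth A \<inter> class_truth B \<in> down_sets nested (index_pairs m)"
    using class_truth_down_set[OF A] class_truth_down_set[OF B] unfolding down_sets_def by blast+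
  moreover have "down_imp nested (index_pairs m) (class_truth A) (class_truth B)
      \<in> down_sets nested (index_pairs m)"
    unfolding down_sets_def down_imp_def by (auto intro: nested_trans)
  ultimately show "hsup (theta_heyting t m) A B \<in> carrier (theta_heyting t m) \<and>
      class_truth (hsup (theta_heyting t m) A B) = class_truth A \<union> class_truth B"
    "hinf (theta_heyting t m) A B \<in> carrier (theta_heyting t m) \<and>
      class_truth (hinf (theta_heyting t m) A B) = class_truth A \<inter> class_truth B"
    "himp (theta_heyting t m) A B \<in> carrier (theta_heyting t m) \<and>
      class_truth (himp (theta_heyting t m) A B) =
        down_imp nested (index_pairs m) (class_truth A) (class_truth B)"
    using class_op_truth[OF A B, of Or "(\<union>)"] class_op_truth[OF A B, of And "(\<inter>)"]
      class_op_truth[OF A B, of Cond "down_imp nested (index_pairs m)"]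
    by (auto simp: theta_heyting_def ITL_def truth_set_connectives)
qed (simp_all add: nested_refl theta_heyting_def)

end

section \<open>The isomorphism between Dyck paths and classes of propositions\<close>

theorem theorem3p1:
  fixes n :: nat and t :: "nat \<Rightarrow> 'a::linorder"
  assumes "n \<ge> 1"
    and "strict_mono_on {1..n - 1} t"
  shows "heyting_algebra (dyck_heyting n)
    \<and> heyting_algebra (theta_heyting t (n - 1))
    \<and> (\<exists>h. h \<in> heyting_iso (dyck_heyting n) (theta_heyting t (n - 1)))"
proof -
  interpret time_line t "n - 1"
    by unfold_locales fact
  show ?thesis
    using heyting_representation.heyting_algebra[OF dyck_heyting_representation]
      heyting_representation.heyting_algebra[OF theta_heyting_representation]
      heyting_iso_of_representations[OF dyck_heyting_representation theta_heyting_representation]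
    by (intro conjI exI)
qed

end
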